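(* Let $k$ be an integer. Then the generalized Bernoulli numbers satisfy, for all $n\ge 0$, $$B_{n}^{(k)}=\sum_{j=0}^{n}\binom{k}{j}\binom{n-k}{n-j}B_{n}^{(j)}$$ and $$\binom{n+k}{n}B_{n}^{(k)}=\sum_{j=0}^{n}\binom{n+k}{n+j}\binom{n+j}{n}\binom{n-k}{n-j}B_{n}^{(j)}.$$
   Context: For any integer $m$, the generalized Bernoulli numbers $B_n^{(m)}$ are defined by the formal power series identity $\left(1+\sum_{n\geq 1}\frac{1}{(n+1)!}X^{n}\right)^{-m}=1+\sum_{n\geq 1}\frac{1}{n!}B_{n}^{(m)}X^{n}$, with $B_0^{(m)}=1$. Binomial coefficients are generalized: $\binom{x}{p}=x(x-1)\cdots(x-p+1)/p!$ for any integer $x$ (possibly negative) and $p\ge 0$. *)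

theory Defs
  imports Complex_Main "HOL-Computational_Algebra.Formal_Power_Series"
begin

(* The series 1 + (SUM n >= 1. X^n / (n+1)!); the leading 1 is the n = 0 coefficient 1/1!.
   It is a unit, so the integer power below is a genuine one for either sign of the exponent. *)
definition gen_bernoulli_base :: "rat fps" where
  "gen_bernoulli_base = Abs_fps (\<lambda>n. 1 / fact (n + 1))"

definition gen_bernoulli :: "int \<Rightarrow> nat \<Rightarrow> rat" where
  "gen_bernoulli m n = fact n * fps_nth (gen_bernoulli_base powi (- m)) n"

lemma gen_bernoulli_base_mult_inverse:
  "gen_bernoulli_base * inverse gen_bernoulli_base = 1"
  by (simp add: gen_bernoulli_base_def inverse_mult_eq_1')

lemma gen_bernoulli_egf:
  "gen_bernoulli_base powi (- m) = Abs_fps (\<lambda>n. gen_bernoulli m n / fact n)"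
  by (simp add: gen_bernoulli_def fps_eq_iff)

lemma gen_bernoulli_0_right: "gen_bernoulli m 0 = 1"
  by (simp add: gen_bernoulli_def gen_bernoulli_base_def power_int_def fps_nth_power_0)

end

theory Submission
  imports Defs
begin

text \<open>
  For fixed \<open>n\<close>, the number \<open>gen_bernoulli k n\<close> is a polynomial in \<open>k\<close> of degree at most \<open>n\<close>:
  writing the inverse of the base series as \<open>1 + u\<close> with \<open>u\<close> of positive order, the binomial series
  gives \<open>(1 + u)^k = (\<Sum>i. (k gchoose i) * u^i)\<close>, and only the powers \<open>u^i\<close> with \<open>i \<le> n\<close> reach
  the coefficient of \<open>X^n\<close>. This holds for negative \<open>k\<close> as well.

  The first identity is then Lagrange interpolation at the nodes \<open>0, ..., n\<close>: the polynomial
  \<open>(x gchoose j) * (n - x gchoose (n - j))\<close> of degree \<open>n\<close> is \<open>1\<close> at \<open>x = j\<close> and \<open>0\<close> at the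
  other nodes. In the basis \<open>x gchoose i\<close> that occurs above, interpolation is an instance of
  the Chu-Vandermonde convolution.

  The second identity is the first one multiplied by \<open>n + k gchoose n\<close>, because
  \<open>(n + k gchoose (n + j)) * (n + j choose n) = (n + k gchoose n) * (k gchoose j)\<close>.
\<close>

text \<open>
  Trinomial revision pulls \<open>x gchoose i\<close> out of the sum; what remains is the Vandermonde convolution
  of \<open>x - i\<close> and \<open>n - x\<close>, whose value \<open>n - i gchoose (n - i) = 1\<close> no longer depends on \<open>x\<close>.
\<close>

lemma gbinomial_interpolation:
  fixes x :: "'a :: field_char_0"
  assumes "i \<le> n"
  shows "(\<Sum>j=0..n. (x gchoose j) * (of_nat n - x gchoose (n - j)) * (of_nat j gchoose i)) = x gchoose i"
proof -
  let ?t = "\<lambda>j. (x gchoose j) * (of_nat n - x gchoose (n - j)) * (of_nat j gchoose i)"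
  have "(\<Sum>j=0..n. ?t j) = (\<Sum>j=i..n. ?t j)"
    by (rule sum.mono_neutral_right) (auto simp flip: binomial_gbinomial)
  also have "\<dots> = (\<Sum>j=0..n - i. ?t (j + i))"
    using sum.shift_bounds_cl_nat_ivl[of ?t 0 i "n - i"] assms by simp
  also have "\<dots> = (\<Sum>j=0..n - i. (x gchoose i) *
                    ((x - of_nat i gchoose j) * (of_nat n - x gchoose (n - i - j))))"
  proof (rule sum.cong)
    fix j assume "j \<in> {0..n - i}"
    have "(x gchoose (j + i)) * (of_nat (j + i) gchoose i)
            = (x gchoose i) * (x - of_nat i gchoose j)"
      using gbinomial_trinomial_revision[of i "j + i" x] by simp
    moreover have "?t (j + i) = (x gchoose (j + i)) * (of_nat (j + i) gchoose i)
                     * (of_nat n - x gchoose (n - i - j))"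
      by (simp add: mult_ac add.commute)
    ultimately show "?t (j + i) = (x gchoose i) *
        ((x - of_nat i gchoose j) * (of_nat n - x gchoose (n - i - j)))"
      by (simp only: mult.assoc)
  qed simp
  also have "\<dots> = (x gchoose i) * ((x - of_nat i) + (of_nat n - x) gchoose (n - i))"
    by (simp only: gbinomial_Vandermonde flip: sum_distrib_left)
  also have "(x - of_nat i) + (of_nat n - x) = of_nat (n - i)"
    using assms by (simp add: of_nat_diff)
  also have "(of_nat (n - i) gchoose (n - i) :: 'a) = 1"
    by (simp flip: binomial_gbinomial)
  finally show ?thesis
    by simp
qed

text \<open>
  The binomial theorem for integer powers of a power series with constant term \<open>1\<close>, obtained by
  substituting \<open>f - 1\<close> for \<open>X\<close> in the binomial series for \<open>1 + X\<close>.
\<close>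

lemma fps_power_int_eq_binomial_compose:
  fixes f :: "'a :: field_char_0 fps"
  assumes "fps_nth f 0 = 1"
  shows "f powi m = fps_compose (fps_binomial (of_int m)) (f - 1)"
proof -
  have u0: "fps_nth (f - 1) 0 = 0"
    using assms by simp
  have pow: "fps_compose (fps_binomial (of_nat n)) (f - 1) = f ^ n" for n
    using u0 by (simp add: fps_binomial_of_nat fps_compose_add_distrib flip: fps_compose_power)
  show ?thesis
  proof (cases "m \<ge> 0")
    case True
    then show ?thesis
      using pow[of "nat m"] by (simp add: power_int_def)
  next
    case False
    define n where "n = nat (- m)"
    have m: "of_int m = (- of_nat n :: 'a)"
      using False by (simp add: n_def)
    have "fps_compose (fps_binomial (of_int m)) (f - 1) = fps_compose (inverse (fps_binomial (of_nat n))) (f - 1)"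
      using fps_binomial_minus_of_nat[of n, where ?'a = 'a] m
      by (simp only: fps_binomial_of_nat)
    also have "\<dots> = inverse (f ^ n)"
      using u0 by (simp add: fps_inverse_compose pow)
    finally show ?thesis
      using False by (simp add: power_int_def n_def fps_inverse_power)
  qed
qed

text \<open>
  The numbers \<open>c i\<close> do not depend on \<open>k\<close>, so this exhibits \<open>gen_bernoulli k n\<close> as a polynomial in
  \<open>k\<close> of degree at most \<open>n\<close>.
\<close>

lemma gen_bernoulli_polynomial:
  obtains c :: "nat \<Rightarrow> rat"
  where "\<And>k. gen_bernoulli k n = (\<Sum>i=0..n. c i * (of_int k gchoose i))"
proof
  fix k :: int
  let ?g = "inverse gen_bernoulli_base"
  have base0: "fps_nth gen_bernoulli_base 0 = 1"
    by (simp add: gen_bernoulli_base_def)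
  \<comment> \<open>Expanding around the inverse series makes the exponent \<open>k\<close> itself, rather than \<open>- k\<close>, the
    upper argument of the binomial coefficients.\<close>
  have "gen_bernoulli_base powi (- k) = ?g powi k"
    using base0 by (auto simp: power_int_def fps_inverse_idempotent)
  then have "gen_bernoulli k n = fact n * fps_nth (fps_compose (fps_binomial (of_int k)) (?g - 1)) n"
    using base0 by (simp add: gen_bernoulli_def fps_power_int_eq_binomial_compose)
  then show "gen_bernoulli k n
      = (\<Sum>i=0..n. (fact n * fps_nth ((?g - 1) ^ i) n) * (of_int k gchoose i))"
    by (simp add: fps_compose_nth sum_distrib_left mult_ac)
qed

lemma gen_bernoulli_interpolation:
  "gen_bernoulli k n =
     (\<Sum>j=0..n. (of_int k gchoose j) * (of_int (int n - k) gchoose (n - j)) * gen_bernoulli (int j) n)"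
proof -
  obtain c where c: "\<And>k. gen_bernoulli k n = (\<Sum>i=0..n. c i * (of_int k gchoose i))"
    using gen_bernoulli_polynomial[of n] by blast
  let ?w = "\<lambda>j. (of_int k gchoose j) * (of_int (int n - k) gchoose (n - j)) :: rat"
  have "(\<Sum>j=0..n. ?w j * gen_bernoulli (int j) n)
          = (\<Sum>j=0..n. \<Sum>i=0..n. c i * (?w j * (of_nat j gchoose i)))"
    by (simp add: c sum_distrib_left mult_ac)
  also have "\<dots> = (\<Sum>i=0..n. c i * (\<Sum>j=0..n. ?w j * (of_nat j gchoose i)))"
    by (subst sum.swap) (simp add: sum_distrib_left)
  also have "\<dots> = (\<Sum>i=0..n. c i * (of_int k gchoose i))"
    using gbinomial_interpolation[of _ n "of_int k :: rat"] by (intro sum.cong) simp_all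
  also have "\<dots> = gen_bernoulli k n"
    by (simp add: c)
  finally show ?thesis ..
qed

theorem theorem2p10:
  fixes k :: int and n :: nat
  shows "gen_bernoulli k n =
           (\<Sum>j=0..n. (of_int k gchoose j) * (of_int (int n - k) gchoose (n - j))
                       * gen_bernoulli (int j) n)
       \<and> (of_int (int n + k) gchoose n) * gen_bernoulli k n =
           (\<Sum>j=0..n. (of_int (int n + k) gchoose (n + j)) * of_nat ((n + j) choose n)
                       * (of_int (int n - k) gchoose (n - j)) * gen_bernoulli (int j) n)"
proof
  have revision: "(of_int (int n + k) gchoose (n + j)) * of_nat ((n + j) choose n)
      = (of_int (int n + k) gchoose n) * (of_int k gchoose j :: rat)" for j
    using gbinomial_trinomial_revision[of n "n + j" "of_int (int n + k) :: rat"]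
    unfolding binomial_gbinomial by simp
  show "(of_int (int n + k) gchoose n) * gen_bernoulli k n =
           (\<Sum>j=0..n. (of_int (int n + k) gchoose (n + j)) * of_nat ((n + j) choose n)
                       * (of_int (int n - k) gchoose (n - j)) * gen_bernoulli (int j) n)"
    unfolding revision
    by (subst gen_bernoulli_interpolation) (simp add: sum_distrib_left mult.assoc)
qed (rule gen_bernoulli_interpolation)

end
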